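(* Let $a<b$, let $0<\alpha,\beta\le 1$ with $\alpha+\beta>1$, and let $\psi\in C^1_+[a,b]$. Let $f$ be a real-valued function of $(t,x)$, and let $\mathcal{G}$ be a real-valued functional on $C[a,b]$. Suppose $x$ is a solution of the boundary value problem $$\left({}^C D_{a+}^{\alpha,\psi}\,{}^C D_{a+}^{\beta,\psi}x\right)(t)+f(t,x(t))=0,\quad a<t<b,\qquad x(a)=0,\quad x(b)=\mathcal{G}(x),$$ such that ${}^C D_{a+}^{\beta,\psi}x\in C^1[a,b]$ and $f(\cdot,x(\cdot))\in C^1[a,b]$. Then, for all $t\in[a,b]$, $$x(t)=\left(\frac{\psi(t)-\psi(a)}{\psi(b)-\psi(a)}\right)^{\beta}\mathcal{G}(x)+\int_a^b G(\tau,t)\,\psi'(\tau)\,f(\tau,x(\tau))\,d\tau,$$ where $$G(\tau,t)=\begin{cases} C(\psi(t)-\psi(a))^\beta(\psi(b)-\psi(\tau))^{\alpha+\beta-1}-D(\psi(t)-\psi(\tau))^{\alpha+\beta-1}, & a\le\tau\le t\le b,\\ C(\psi(t)-\psi(a))^\beta(\psi(b)-\psi(\tau))^{\alpha+\beta-1}, & a\le t\le\tau\le b,\end{cases}$$ with $C=\dfrac{1}{\Gamma(\alpha+\beta)(\psi(b)-\psi(a))^{\beta}}$ and $D=\dfrac{1}{\Gamma(\alpha+\beta)}$.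
   Context: $C^1_+[a,b]=\{\psi\in C^1[a,b]:\psi'(t)>0 \text{ for all } t\in[a,b]\}$; $\Gamma$ is the Gamma function. For $\gamma>0$ and $y\in L^1[a,b]$, the left fractional integral of $y$ with respect to $\psi$ is $I_{a+}^{\gamma,\psi}y(t)=\frac{1}{\Gamma(\gamma)}\int_a^t\psi'(\tau)(\psi(t)-\psi(\tau))^{\gamma-1}y(\tau)\,d\tau$; $I_{a+}^{0,\psi}$ is the identity. For $0<\gamma\le 1$ and $y\in C^1[a,b]$, the left $\psi$-Caputo fractional derivative of order $\gamma$ is ${}^C D_{a+}^{\gamma,\psi}y(t)=I_{a+}^{1-\gamma,\psi}\left(\frac{y'}{\psi'}\right)(t)$. A solution $x$ of the problem is a function in $C^1[a,b]$ (so that ${}^C D_{a+}^{\beta,\psi}x$ is defined) satisfying the equation on $(a,b)$ and the boundary conditions. *)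

theory Defs
  imports "HOL-Analysis.Analysis"
begin

(* Derivative of a function on the closed interval [a,b]; one-sided at the endpoints,
   so the values of the function outside [a,b] play no role. *)
definition deriv_on :: "real \<Rightarrow> real \<Rightarrow> (real \<Rightarrow> real) \<Rightarrow> real \<Rightarrow> real" where
  "deriv_on a b y t = vector_derivative y (at t within {a..b})"

definition C1_on :: "real \<Rightarrow> real \<Rightarrow> (real \<Rightarrow> real) set" where
  "C1_on a b = {y. y differentiable_on {a..b} \<and> continuous_on {a..b} (deriv_on a b y)}"

definition C1_plus_on :: "real \<Rightarrow> real \<Rightarrow> (real \<Rightarrow> real) set" where
  "C1_plus_on a b = {\<psi> \<in> C1_on a b. \<forall>t\<in>{a..b}. deriv_on a b \<psi> t > 0}"

(* The right endpoint b enters only through the derivative of \<psi> on [a,b]. The value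
   0 powr (\<gamma> - 1) = 0 of the kernel at \<tau> = t affects only a null set. *)
definition frac_int ::
  "real \<Rightarrow> real \<Rightarrow> real \<Rightarrow> (real \<Rightarrow> real) \<Rightarrow> (real \<Rightarrow> real) \<Rightarrow> real \<Rightarrow> real" where
  "frac_int a b \<gamma> \<psi> y t =
     (if \<gamma> = 0 then y t
      else 1 / Gamma \<gamma> *
        (LINT \<tau>:{a..t}|lebesgue. deriv_on a b \<psi> \<tau> * (\<psi> t - \<psi> \<tau>) powr (\<gamma> - 1) * y \<tau>))"

definition caputo ::
  "real \<Rightarrow> real \<Rightarrow> real \<Rightarrow> (real \<Rightarrow> real) \<Rightarrow> (real \<Rightarrow> real) \<Rightarrow> real \<Rightarrow> real" where
  "caputo a b \<gamma> \<psi> y =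
     frac_int a b (1 - \<gamma>) \<psi> (\<lambda>\<tau>. deriv_on a b y \<tau> / deriv_on a b \<psi> \<tau>)"

(* A functional on C[a,b] is modelled by an arbitrary function \<G> that is only ever applied to
   restrict x {a..b} with x continuous on [a,b], so that \<G>(x) depends only on x on [a,b]. *)
definition bvp_solution ::
  "real \<Rightarrow> real \<Rightarrow> real \<Rightarrow> real \<Rightarrow> (real \<Rightarrow> real) \<Rightarrow> (real \<Rightarrow> real \<Rightarrow> real) \<Rightarrow>
   ((real \<Rightarrow> real) \<Rightarrow> real) \<Rightarrow> (real \<Rightarrow> real) \<Rightarrow> bool" where
  "bvp_solution a b \<alpha> \<beta> \<psi> f \<G> x \<longleftrightarrow>
     x \<in> C1_on a b \<and>
     (\<forall>t\<in>{a<..<b}. caputo a b \<alpha> \<psi> (caputo a b \<beta> \<psi> x) t + f t (x t) = 0) \<and>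
     x a = 0 \<and> x b = \<G> (restrict x {a..b})"

definition green ::
  "real \<Rightarrow> real \<Rightarrow> real \<Rightarrow> real \<Rightarrow> (real \<Rightarrow> real) \<Rightarrow> real \<Rightarrow> real \<Rightarrow> real" where
  "green a b \<alpha> \<beta> \<psi> \<tau> t =
     (let C = 1 / (Gamma (\<alpha> + \<beta>) * (\<psi> b - \<psi> a) powr \<beta>);
          D = 1 / Gamma (\<alpha> + \<beta>)
      in if \<tau> \<le> t
         then C * (\<psi> t - \<psi> a) powr \<beta> * (\<psi> b - \<psi> \<tau>) powr (\<alpha> + \<beta> - 1)
              - D * (\<psi> t - \<psi> \<tau>) powr (\<alpha> + \<beta> - 1)
         else C * (\<psi> t - \<psi> a) powr \<beta> * (\<psi> b - \<psi> \<tau>) powr (\<alpha> + \<beta> - 1))"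

end

theory Submission
  imports Defs
begin

text \<open>
  Substituting \<open>u = (\<psi> \<tau> - \<psi> s) / (\<psi> t - \<psi> s)\<close> in Euler's Beta integral and applying Fubini gives
  the semigroup law \<open>I\<^sup>\<gamma> I\<^sup>\<delta> = I\<^sup>\<gamma>\<^sup>+\<^sup>\<delta>\<close> on continuous functions, hence \<open>I\<^sup>\<gamma>\<close> applied to the Caputo
  derivative of order \<open>\<gamma>\<close> of \<open>y\<close> is \<open>I\<^sup>1 (y' / \<psi>') = y - y a\<close>. Writing \<open>v\<close> for the Caputo derivative
  of order \<open>\<beta>\<close> of \<open>x\<close> and \<open>F \<tau> = f \<tau> (x \<tau>)\<close>, the equation becomes \<open>v = v a - I\<^sup>\<alpha> F\<close>, so
  \<open>x t = v a * (\<psi> t - \<psi> a)\<^sup>\<beta> / \<Gamma>(\<beta> + 1) - I\<^sup>\<alpha>\<^sup>+\<^sup>\<beta> F t\<close>, and the condition at \<open>b\<close> eliminates \<open>v a\<close>.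
\<close>

section \<open>Integrals under almost everywhere equality, and Gamma identities\<close>

text \<open>No measurability is assumed: Lebesgue measure is complete, so almost everywhere equality
  transfers measurability, and if neither function is measurable both integrals take the default
  value 0.\<close>

lemma integral_lebesgue_cong_AE:
  fixes f g :: "real \<Rightarrow> real"
  assumes "AE x in lebesgue. f x = g x"
  shows "integral\<^sup>L lebesgue f = integral\<^sup>L lebesgue g"
proof (cases "f \<in> borel_measurable lebesgue")
  case True
  then show ?thesis
    using borel_measurable_AE[OF True assms] assms by (intro integral_cong_AE)
next
  case False
  have "AE x in lebesgue. g x = f x"
    using assms by eventually_elim simp
  then have "g \<notin> borel_measurable lebesgue"
    using False borel_measurable_AE by blast
  with False have "\<not> integrable lebesgue f" "\<not> integrable lebesgue g"
    by auto
  then show ?thesis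
    by (simp add: not_integrable_integral_eq)
qed

lemma AE_lebesgue_neq: "AE x in lebesgue. x \<noteq> (c::real)"
  using AE_completion AE_lborel_singleton by blast

lemma Gamma_real_nonzero: "x > 0 \<Longrightarrow> Gamma x \<noteq> (0::real)"
  using Gamma_real_pos[of x] by linarith

lemma Gamma_real_plus1: "x > 0 \<Longrightarrow> Gamma (x + 1) = x * Gamma (x::real)"
  by (rule Gamma_plus1) (auto simp: nonpos_Ints_def)

text \<open>Two points form a null set. One exception absorbs the convention
  \<open>0 powr 0 = 0\<close> at an end of the interval; two are needed for an equation known only
  on an open interval.\<close>

lemma set_integral_lebesgue_cong_except:
  fixes f g :: "real \<Rightarrow> real"
  assumes "\<And>x. x \<in> A \<Longrightarrow> x \<noteq> c \<Longrightarrow> x \<noteq> d \<Longrightarrow> f x = g x"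
  shows "(LINT x:A|lebesgue. f x) = (LINT x:A|lebesgue. g x)"
  unfolding set_lebesgue_integral_def
proof (rule integral_lebesgue_cong_AE)
  show "AE x in lebesgue. indicator A x *\<^sub>R f x = indicator A x *\<^sub>R g x"
    using AE_lebesgue_neq[of c] AE_lebesgue_neq[of d]
    by eventually_elim (auto simp: assms indicator_def)
qed

section \<open>Calculus of continuously differentiable functions on a closed interval\<close>

lemma C1_onD:
  assumes "y \<in> C1_on a b" "t \<in> {a..b}"
  shows "(y has_field_derivative deriv_on a b y t) (at t within {a..b})"
proof -
  have "y differentiable (at t within {a..b})"
    using assms by (auto simp: C1_on_def differentiable_on_def)
  then show ?thesis
    by (simp add: vector_derivative_works deriv_on_def has_real_derivative_iff_has_vector_derivative)
qed

lemma C1_on_continuous: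
  assumes "y \<in> C1_on a b"
  shows "continuous_on {a..b} y" "continuous_on {a..b} (deriv_on a b y)"
  using assms by (auto simp: C1_on_def differentiable_imp_continuous_on)

lemma integral_deriv_on:
  assumes "y \<in> C1_on a b" "t \<in> {a..b}"
  shows "(LINT \<tau>:{a..t}|lebesgue. deriv_on a b y \<tau>) = y t - y a"
proof -
  have "(deriv_on a b y has_integral y t - y a) {a..t}"
  proof (rule fundamental_theorem_of_calculus)
    show "(y has_vector_derivative deriv_on a b y \<tau>) (at \<tau> within {a..t})"
      if "\<tau> \<in> {a..t}" for \<tau>
      using C1_onD[OF assms(1), of \<tau>] that assms(2)
      by (auto simp flip: has_real_derivative_iff_has_vector_derivative
               intro: DERIV_subset)
  qed (use assms in auto)
  moreover have "continuous_on {a..t} (deriv_on a b y)"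
    using C1_on_continuous(2)[OF assms(1)] assms(2) by (auto intro: continuous_on_subset)
  then have "set_integrable lebesgue {a..t} (deriv_on a b y)"
    by (rule absolutely_integrable_continuous_real)
  ultimately show ?thesis
    by (simp add: set_lebesgue_integral_eq_integral integral_unique)
qed

section \<open>Monotonicity of \<open>\<psi>\<close> and integrals of its fractional kernel\<close>

context
  fixes a b :: real and \<psi> :: "real \<Rightarrow> real"
  assumes ab: "a < b" and \<psi>: "\<psi> \<in> C1_plus_on a b"
begin

abbreviation (input) "\<psi>' \<equiv> deriv_on a b \<psi>"

lemma psi_C1: "\<psi> \<in> C1_on a b" and psi'_pos: "t \<in> {a..b} \<Longrightarrow> \<psi>' t > 0"
  using \<psi> by (auto simp: C1_plus_on_def)

lemma psi_cont: "continuous_on {a..b} \<psi>" and psi'_cont: "continuous_on {a..b} \<psi>'"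
  using C1_on_continuous[OF psi_C1] .

lemma psi_less:
  assumes "a \<le> s" "s < t" "t \<le> b"
  shows "\<psi> s < \<psi> t"
proof (rule DERIV_pos_imp_increasing_open[where f = \<psi>])
  show "continuous_on {s..t} \<psi>"
    using psi_cont by (rule continuous_on_subset) (use assms in auto)
  show "\<exists>y. (\<psi> has_real_derivative y) (at x) \<and> y > 0" if "s < x" "x < t" for x
    using C1_onD[OF psi_C1, of x] psi'_pos[of x] that assms by (auto simp: at_within_Icc_at)
qed (use assms in auto)

lemma psi_le: "a \<le> s \<Longrightarrow> s \<le> t \<Longrightarrow> t \<le> b \<Longrightarrow> \<psi> s \<le> \<psi> t"
  using psi_less[of s t] by (cases "s = t") auto

lemma psi_Beta_integral:
  assumes st: "a \<le> s" "s \<le> t" "t \<le> b" and pos: "\<gamma> > 0" "\<delta> > 0"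
  shows "set_integrable lebesgue {s..t}
           (\<lambda>\<tau>. \<psi>' \<tau> * (\<psi> t - \<psi> \<tau>) powr (\<gamma> - 1) * (\<psi> \<tau> - \<psi> s) powr (\<delta> - 1))"
    and "(LINT \<tau>:{s..t}|lebesgue.
           \<psi>' \<tau> * (\<psi> t - \<psi> \<tau>) powr (\<gamma> - 1) * (\<psi> \<tau> - \<psi> s) powr (\<delta> - 1))
         = Beta \<gamma> \<delta> * (\<psi> t - \<psi> s) powr (\<gamma> + \<delta> - 1)"
proof -
  let ?k = "\<lambda>\<tau>. \<psi>' \<tau> * (\<psi> t - \<psi> \<tau>) powr (\<gamma> - 1) * (\<psi> \<tau> - \<psi> s) powr (\<delta> - 1)"
  have "set_integrable lebesgue {s..t} ?k \<and>
    (LINT \<tau>:{s..t}|lebesgue. ?k \<tau>) = Beta \<gamma> \<delta> * (\<psi> t - \<psi> s) powr (\<gamma> + \<delta> - 1)"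
  proof (cases "s = t")
    \<comment> \<open>Both sides vanish: the interval is a single point, and on the right
      \<open>0 powr r = 0\<close> for every \<open>r\<close>.\<close>
    case True
    have "continuous_on {s..t} ?k" using True by simp
    then have "set_integrable lebesgue {s..t} ?k"
      by (rule absolutely_integrable_continuous_real)
    then show ?thesis
      using True by (simp add: set_lebesgue_integral_eq_integral)
  next
    case False
    with st have "s < t" by simp
    define L where "L = \<psi> t - \<psi> s"
    have L: "L > 0" using psi_less[of s t] st \<open>s < t\<close> by (simp add: L_def)
    define g where "g = (\<lambda>\<tau>. (\<psi> \<tau> - \<psi> s) / L)"
    define F where "F = (\<lambda>u::real. u powr (\<delta> - 1) * (1 - u) powr (\<gamma> - 1))"
    have F: "(F has_integral Beta \<delta> \<gamma>) {0..1}"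
      unfolding F_def by (rule has_integral_Beta_real) (use pos in auto)
    \<comment> \<open>For exponents below 1 the integrand is singular at the ends; being nonnegative
      and gauge integrable, it is still absolutely integrable.\<close>
    have Fabs: "F absolutely_integrable_on {0..1}"
      by (rule nonnegative_absolutely_integrable_1) (use F in \<open>auto simp: F_def integrable_on_def\<close>)
    have inj: "inj_on g {s..t}"
    proof (rule inj_onI)
      fix p q assume "p \<in> {s..t}" "q \<in> {s..t}" "g p = g q"
      then show "p = q"
        using psi_less[of p q] psi_less[of q p] L st by (cases p q rule: linorder_cases) (auto simp: g_def)
    qed
    have img: "g ` {s..t} = {0..1}"
    proof
      show "g ` {s..t} \<subseteq> {0..1}"
        using st L psi_le by (auto simp: g_def L_def field_simps)
      have "continuous_on {s..t} g"
        unfolding g_def using L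
        by (intro continuous_intros continuous_on_subset[OF psi_cont]) (use st in auto)
      moreover have "g s = 0" "g t = 1" using L by (auto simp: g_def L_def)
      ultimately show "{0..1} \<subseteq> g ` {s..t}"
        using IVT'[of g s _ t] st by (force simp: image_iff)
    qed
    have der: "(g has_field_derivative \<psi>' \<tau> / L) (at \<tau> within {s..t})" if "\<tau> \<in> {s..t}" for \<tau>
    proof -
      have "(\<psi> has_field_derivative \<psi>' \<tau>) (at \<tau> within {s..t})"
        using C1_onD[OF psi_C1, of \<tau>] by (rule DERIV_subset) (use that st in auto)
      then show ?thesis
        unfolding g_def using L by (auto intro!: derivative_eq_intros)
    qed
    \<comment> \<open>The substitution contributes \<open>1 / L\<close> from the derivative of
      \<open>g\<close> and \<open>L\<close> to the powers \<open>1 - \<delta>\<close> and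
      \<open>1 - \<gamma>\<close> from the two factors of \<open>F\<close>, in total
      \<open>1 / c\<close>.\<close>
    define c where "c = L powr (\<gamma> + \<delta> - 1)"
    have c: "c > 0" using L by (simp add: c_def)
    have eq: "\<bar>\<psi>' \<tau> / L\<bar> * F (g \<tau>) = ?k \<tau> / c" if "\<tau> \<in> {s..t}" for \<tau>
    proof -
      have "1 - g \<tau> = (\<psi> t - \<psi> \<tau>) / L" using L by (simp add: g_def L_def field_simps)
      moreover have "\<psi> \<tau> \<ge> \<psi> s" "\<psi> \<tau> \<le> \<psi> t" "\<psi>' \<tau> > 0"
        using psi_le psi'_pos that st by auto
      moreover have "c = L * (L powr (\<delta> - 1) * L powr (\<gamma> - 1))"
        using L by (simp add: c_def powr_mult_base flip: powr_add) (simp add: algebra_simps)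
      ultimately show ?thesis
        using L by (simp add: F_def g_def powr_divide)
    qed
    \<comment> \<open>The change of variables is an equivalence covering integrability and value
      together, so both pass from \<open>F\<close> on the unit interval to the kernel.\<close>
    from has_absolute_integral_change_of_variables_1'[OF _ der inj, of F "Beta \<delta> \<gamma>"]
    have "(\<lambda>\<tau>. \<bar>\<psi>' \<tau> / L\<bar> * F (g \<tau>)) absolutely_integrable_on {s..t}"
      "integral {s..t} (\<lambda>\<tau>. \<bar>\<psi>' \<tau> / L\<bar> * F (g \<tau>)) = Beta \<delta> \<gamma>"
      using Fabs integral_unique[OF F] by (auto simp: img)
    then have "set_integrable lebesgue {s..t} (\<lambda>\<tau>. ?k \<tau> / c)"
      and "integral {s..t} (\<lambda>\<tau>. ?k \<tau> / c) = Beta \<delta> \<gamma>"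
      by (simp_all only: eq cong: set_integrable_cong integral_cong)
    then have "set_integrable lebesgue {s..t} (\<lambda>\<tau>. ?k \<tau> / c)"
      "(LINT \<tau>:{s..t}|lebesgue. ?k \<tau> / c) = Beta \<delta> \<gamma>"
      by (simp_all only: set_lebesgue_integral_eq_integral)
    then show ?thesis
      using c by (auto simp: c_def L_def Beta_commute field_simps)
  qed
  then show "set_integrable lebesgue {s..t} ?k"
    "(LINT \<tau>:{s..t}|lebesgue. ?k \<tau>) = Beta \<gamma> \<delta> * (\<psi> t - \<psi> s) powr (\<gamma> + \<delta> - 1)"
    by auto
qed

text \<open>This is the Beta integral with \<open>\<delta> = 1\<close> and
  \<open>s = a\<close>.\<close>

lemma psi_kernel_integral:
  assumes t: "a \<le> t" "t \<le> b" and pos: "\<gamma> > 0"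
  shows "set_integrable lebesgue {a..t} (\<lambda>\<tau>. \<psi>' \<tau> * (\<psi> t - \<psi> \<tau>) powr (\<gamma> - 1))"
    and "(LINT \<tau>:{a..t}|lebesgue. \<psi>' \<tau> * (\<psi> t - \<psi> \<tau>) powr (\<gamma> - 1)) = (\<psi> t - \<psi> a) powr \<gamma> / \<gamma>"
proof -
  have ne: "\<psi> \<tau> - \<psi> a \<noteq> 0" if "\<tau> \<in> {a..t}" "\<tau> \<noteq> a" for \<tau>
    using psi_less[of a \<tau>] that t by auto
  \<comment> \<open>\<open>0 powr 0 = 0\<close>, so the exponent \<open>\<delta> - 1 = 0\<close> yields the factor \<open>1\<close> only away from \<open>\<tau> = a\<close>.\<close>
  have B: "Beta \<gamma> 1 = 1 / \<gamma>"
    using pos by (simp add: Beta_def Gamma_real_nonzero Gamma_real_plus1)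
  note int = psi_Beta_integral[of a t \<gamma> 1]
  show "set_integrable lebesgue {a..t} (\<lambda>\<tau>. \<psi>' \<tau> * (\<psi> t - \<psi> \<tau>) powr (\<gamma> - 1))"
    by (rule absolutely_integrable_spike[OF int(1), of "{a}"]) (use t pos ne in auto)
  have "(LINT \<tau>:{a..t}|lebesgue. \<psi>' \<tau> * (\<psi> t - \<psi> \<tau>) powr (\<gamma> - 1))
      = (LINT \<tau>:{a..t}|lebesgue. \<psi>' \<tau> * (\<psi> t - \<psi> \<tau>) powr (\<gamma> - 1) * (\<psi> \<tau> - \<psi> a) powr (1 - 1))"
    by (rule set_integral_lebesgue_cong_except[of _ a a]) (use ne in auto)
  then show "(LINT \<tau>:{a..t}|lebesgue. \<psi>' \<tau> * (\<psi> t - \<psi> \<tau>) powr (\<gamma> - 1)) = (\<psi> t - \<psi> a) powr \<gamma> / \<gamma>"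
    using int(2) t pos by (simp add: B)
qed

text \<open>The kernel may be unbounded near \<open>t\<close>, but it is absolutely integrable, and
  \<open>y\<close> is bounded and measurable on the compact interval.\<close>

lemma psi_kernel_mult_integrable:
  assumes t: "a \<le> t" "t \<le> b" and pos: "\<gamma> > 0" and y: "continuous_on {a..b} y"
  shows "set_integrable lebesgue {a..t} (\<lambda>\<tau>. \<psi>' \<tau> * (\<psi> t - \<psi> \<tau>) powr (\<gamma> - 1) * y \<tau>)"
proof -
  have y': "continuous_on {a..t} y"
    using y by (rule continuous_on_subset) (use t in auto)
  have "set_integrable lebesgue {a..t} (\<lambda>\<tau>. y \<tau> * (\<psi>' \<tau> * (\<psi> t - \<psi> \<tau>) powr (\<gamma> - 1)))"
  proof (rule absolutely_integrable_bounded_measurable_product_real)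
    show "bounded (y ` {a..t})"
      by (intro compact_imp_bounded compact_continuous_image y') simp
    show "y \<in> borel_measurable (lebesgue_on {a..t})"
      by (intro continuous_imp_measurable_on_sets_lebesgue y') simp
  qed (use psi_kernel_integral t pos in auto)
  then show ?thesis by (simp add: mult_ac)
qed

section \<open>Semigroup law for fractional integrals\<close>

text \<open>The double integral over the triangle \<open>a \<le> s \<le> \<tau> \<le> t\<close> is
  computed in both orders. Integrating over \<open>\<tau>\<close> first produces a Beta factor and
  the kernel of order \<open>\<gamma> + \<delta>\<close>; integrating over \<open>s\<close> first
  produces the iterated fractional integral.\<close>

lemma frac_int_semigroup_pos:
  assumes t: "t \<in> {a..b}" and pos: "\<gamma> > 0" "\<delta> > 0" and y: "continuous_on {a..b} y"
  shows "frac_int a b \<gamma> \<psi> (frac_int a b \<delta> \<psi> y) t = frac_int a b (\<gamma> + \<delta>) \<psi> y t"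
proof -
  \<comment> \<open>Nothing is known outside \<open>{a..b}\<close>; cutting off makes the integrand Borel measurable on the plane.\<close>
  define P p Y where "P = (\<lambda>\<tau>. indicator {a..b} \<tau> *\<^sub>R \<psi> \<tau>)"
    and "p = (\<lambda>\<tau>. indicator {a..b} \<tau> *\<^sub>R \<psi>' \<tau>)" and "Y = (\<lambda>\<tau>. indicator {a..b} \<tau> *\<^sub>R y \<tau>)"
  have [measurable]: "P \<in> borel_measurable borel" "p \<in> borel_measurable borel" "Y \<in> borel_measurable borel"
    unfolding P_def p_def Y_def
    by (intro borel_measurable_continuous_on_indicator psi_cont psi'_cont y; simp)+
  \<comment> \<open>Extension by zero off the triangle lets both orders of integration run over the
    whole line.\<close>
  define H where "H = (\<lambda>s \<tau>. if a \<le> s \<and> s \<le> \<tau> \<and> \<tau> \<le> t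
      then p \<tau> * (P t - P \<tau>) powr (\<gamma> - 1) * (p s * (P \<tau> - P s) powr (\<delta> - 1) * Y s) else 0)"
  have Hm [measurable]: "case_prod H \<in> borel_measurable (borel \<Otimes>\<^sub>M borel)"
    unfolding H_def by measurable
  have Hm' [measurable]: "case_prod H \<in> borel_measurable (lborel \<Otimes>\<^sub>M lborel)"
    using Hm by (simp cong: measurable_cong_sets sets_pair_measure_cong)
  define B where "B = Beta \<gamma> \<delta>"
  define k where "k = (\<lambda>s \<tau>. \<psi>' \<tau> * (\<psi> t - \<psi> \<tau>) powr (\<gamma> - 1) * (\<psi> \<tau> - \<psi> s) powr (\<delta> - 1))"
  have H_eq: "H s = (\<lambda>\<tau>. indicator {a..t} s * \<psi>' s * y s * (indicator {s..t} \<tau> *\<^sub>R k s \<tau>))" for s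
    using t by (auto simp: H_def P_def p_def Y_def k_def fun_eq_iff)
  have k_nonneg: "indicator {s..t} \<tau> *\<^sub>R k s \<tau> \<ge> 0" if "s \<in> {a..t}" for s \<tau>
    using psi'_pos[of \<tau>] t that by (auto simp: k_def indicator_def)
  have H_abs: "norm (H s \<tau>) = indicator {a..t} s * \<psi>' s * \<bar>y s\<bar> * (indicator {s..t} \<tau> *\<^sub>R k s \<tau>)" for s \<tau>
    using k_nonneg[of s \<tau>] psi'_pos[of s] t by (auto simp: H_eq indicator_def abs_mult)
  have k_int: "integrable lebesgue (\<lambda>\<tau>. indicator {s..t} \<tau> *\<^sub>R k s \<tau>)"
      "(LINT \<tau>|lebesgue. indicator {s..t} \<tau> *\<^sub>R k s \<tau>) = B * (\<psi> t - \<psi> s) powr (\<gamma> + \<delta> - 1)"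
    if "s \<in> {a..t}" for s
    using psi_Beta_integral[of s t \<gamma> \<delta>] that t pos
    by (simp_all add: set_integrable_def set_lebesgue_integral_def k_def B_def)
  define K where "K = (\<lambda>z s. indicator {a..t} s *\<^sub>R (\<psi>' s * (\<psi> t - \<psi> s) powr (\<gamma> + \<delta> - 1) * z s))"
  have Hs_int: "integrable lborel (H s)" for s
  proof -
    \<comment> \<open>The kernel facts concern \<open>lebesgue\<close>, Fubini is applied to
      \<open>lborel\<close>. Since \<open>H\<close> is Borel measurable, passing to the completion
      changes neither integrability nor value.\<close>
    have "integrable lebesgue (H s)"
      unfolding H_eq using k_int(1)[of s] by (cases "s \<in> {a..t}") auto
    then show ?thesis by (subst (asm) integrable_completion) auto
  qed
  have Hs_eq: "(LINT \<tau>|lborel. H s \<tau>) = B * K y s" for s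
  proof -
    have "(LINT \<tau>|lborel. H s \<tau>) = (LINT \<tau>|lebesgue. H s \<tau>)"
      by (rule integral_completion[symmetric]) measurable
    also have "\<dots> = B * K y s"
      unfolding H_eq using k_int(2)[of s] by (cases "s \<in> {a..t}") (auto simp: K_def)
    finally show ?thesis .
  qed
  have Hs_norm: "(LINT \<tau>|lborel. norm (H s \<tau>)) = B * K (\<lambda>s. \<bar>y s\<bar>) s" for s
  proof -
    have "(LINT \<tau>|lborel. norm (H s \<tau>)) = (LINT \<tau>|lebesgue. norm (H s \<tau>))"
      by (rule integral_completion[symmetric]) measurable
    also have "\<dots> = B * K (\<lambda>s. \<bar>y s\<bar>) s"
      unfolding H_abs using k_int(2)[of s] by (cases "s \<in> {a..t}") (auto simp: K_def)
    finally show ?thesis .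
  qed
  have "integrable (lborel \<Otimes>\<^sub>M lborel) (case_prod H)"
  proof (rule lborel_pair.Fubini_integrable)
    \<comment> \<open>The kernel is nonnegative, so taking norms only replaces \<open>y\<close> by
      its absolute value, which is again continuous.\<close>
    have "integrable lebesgue (K (\<lambda>s. \<bar>y s\<bar>))"
      unfolding K_def using t pos y
      by (intro psi_kernel_mult_integrable[unfolded set_integrable_def]) (auto intro: continuous_intros)
    then have "integrable lebesgue (\<lambda>s. LINT \<tau>|lborel. norm (H s \<tau>))"
      unfolding Hs_norm by simp
    then show "integrable lborel (\<lambda>s. LINT \<tau>|lborel. norm (case_prod H (s, \<tau>)))"
      by (subst (asm) integrable_completion) auto
  qed (use Hs_int in auto)
  then have fub: "(LINT \<tau>|lborel. LINT s|lborel. H s \<tau>) = (LINT s|lborel. LINT \<tau>|lborel. H s \<tau>)"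
    by (rule lborel_pair.Fubini_integral)
  have "(LINT s|lborel. LINT \<tau>|lborel. H s \<tau>) = (LINT s|lebesgue. LINT \<tau>|lborel. H s \<tau>)"
    by (rule integral_completion[symmetric]) measurable
  also have "\<dots> = B * (LINT s|lebesgue. K y s)"
    unfolding Hs_eq by simp
  finally have R: "(LINT s|lborel. LINT \<tau>|lborel. H s \<tau>) = B * Gamma (\<gamma> + \<delta>) * frac_int a b (\<gamma> + \<delta>) \<psi> y t"
    using pos by (simp add: frac_int_def K_def set_lebesgue_integral_def Gamma_real_nonzero)
  \<comment> \<open>For fixed \<open>\<tau>\<close> the kernel of order \<open>\<gamma>\<close> does
    not depend on \<open>s\<close> and leaves the inner integral.\<close>
  have L0: "(LINT s|lborel. H s \<tau>)
      = indicator {a..t} \<tau> *\<^sub>R (\<psi>' \<tau> * (\<psi> t - \<psi> \<tau>) powr (\<gamma> - 1) * (Gamma \<delta> * frac_int a b \<delta> \<psi> y \<tau>))" for \<tau>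
  proof (cases "\<tau> \<in> {a..t}")
    case True
    have "(LINT s|lborel. H s \<tau>) = (LINT s|lebesgue. H s \<tau>)"
      by (rule integral_completion[symmetric]) measurable
    also have "\<dots> = (LINT s|lebesgue. (\<psi>' \<tau> * (\<psi> t - \<psi> \<tau>) powr (\<gamma> - 1)) *
        (indicator {a..\<tau>} s *\<^sub>R (\<psi>' s * (\<psi> \<tau> - \<psi> s) powr (\<delta> - 1) * y s)))"
      using True t by (intro Bochner_Integration.integral_cong) (auto simp: H_eq k_def indicator_def)
    also have "\<dots> = \<psi>' \<tau> * (\<psi> t - \<psi> \<tau>) powr (\<gamma> - 1) * (Gamma \<delta> * frac_int a b \<delta> \<psi> y \<tau>)"
      using pos by (simp add: frac_int_def set_lebesgue_integral_def Gamma_real_nonzero)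
    finally show ?thesis using True by simp
  next
    case False
    then have "(\<lambda>s. H s \<tau>) = (\<lambda>_. 0)" by (auto simp: H_def)
    with False show ?thesis by simp
  qed
  have "(LINT \<tau>|lborel. LINT s|lborel. H s \<tau>) = (LINT \<tau>|lebesgue. LINT s|lborel. H s \<tau>)"
    by (rule integral_completion[symmetric]) measurable
  also have "\<dots> = (LINT \<tau>|lebesgue. Gamma \<delta> *
      (indicator {a..t} \<tau> *\<^sub>R (\<psi>' \<tau> * (\<psi> t - \<psi> \<tau>) powr (\<gamma> - 1) * frac_int a b \<delta> \<psi> y \<tau>)))"
    unfolding L0 by (simp add: mult_ac)
  also have "\<dots> = Gamma \<delta> * Gamma \<gamma> * frac_int a b \<gamma> \<psi> (frac_int a b \<delta> \<psi> y) t"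
    using pos unfolding frac_int_def[of a b \<gamma>]
    by (simp add: set_lebesgue_integral_def Gamma_real_nonzero)
  \<comment> \<open>By \<open>Beta_def\<close> both sides carry the factor
    \<open>Gamma \<gamma> * Gamma \<delta>\<close>, which is nonzero and cancels.\<close>
  finally show ?thesis
    using fub R pos by (simp add: B_def Beta_def Gamma_real_nonzero)
qed

text \<open>Order \<open>\<delta> = 0\<close> arises from the Caputo derivative of order 1, where
  the fractional integral inside it is the identity.\<close>

lemma frac_int_semigroup:
  assumes t: "t \<in> {a..b}" and "\<gamma> > 0" "\<delta> \<ge> 0" and y: "continuous_on {a..b} y"
  shows "frac_int a b \<gamma> \<psi> (frac_int a b \<delta> \<psi> y) t = frac_int a b (\<gamma> + \<delta>) \<psi> y t"
proof (cases "\<delta> = 0")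
  case True
  then have "frac_int a b \<delta> \<psi> y = y" by (simp add: frac_int_def fun_eq_iff)
  with True show ?thesis by simp
qed (use assms frac_int_semigroup_pos in auto)

section \<open>Inverting the Caputo derivative; linearity and congruence\<close>

lemma frac_int_caputo:
  assumes t: "t \<in> {a..b}" and \<gamma>: "0 < \<gamma>" "\<gamma> \<le> 1" and y: "y \<in> C1_on a b"
  shows "frac_int a b \<gamma> \<psi> (caputo a b \<gamma> \<psi> y) t = y t - y a"
proof -
  have "continuous_on {a..b} (\<lambda>\<tau>. deriv_on a b y \<tau> / \<psi>' \<tau>)"
    using psi'_pos by (intro continuous_intros C1_on_continuous[OF y] psi'_cont) force
  then have "frac_int a b \<gamma> \<psi> (caputo a b \<gamma> \<psi> y) t
      = frac_int a b 1 \<psi> (\<lambda>\<tau>. deriv_on a b y \<tau> / \<psi>' \<tau>) t"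
    unfolding caputo_def using t \<gamma> by (subst frac_int_semigroup) auto
  also have "\<dots> = (LINT \<tau>:{a..t}|lebesgue.
      \<psi>' \<tau> * (\<psi> t - \<psi> \<tau>) powr (1 - 1) * (deriv_on a b y \<tau> / \<psi>' \<tau>))"
    by (simp add: frac_int_def)
  also have "\<dots> = (LINT \<tau>:{a..t}|lebesgue. deriv_on a b y \<tau>)"
  \<comment> \<open>At \<open>\<tau> = t\<close> the kernel is \<open>0 powr 0 = 0\<close> instead
    of 1, hence the exception.\<close>
  proof (rule set_integral_lebesgue_cong_except[of _ t t])
    fix \<tau> assume "\<tau> \<in> {a..t}" "\<tau> \<noteq> t"
    then show "\<psi>' \<tau> * (\<psi> t - \<psi> \<tau>) powr (1 - 1) * (deriv_on a b y \<tau> / \<psi>' \<tau>) = deriv_on a b y \<tau>"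
      using psi_less[of \<tau> t] psi'_pos[of \<tau>] t by auto
  qed
  also have "\<dots> = y t - y a"
    by (rule integral_deriv_on[OF y t])
  finally show ?thesis .
qed

text \<open>Linearity together with the explicit integral of the kernel. The case
  \<open>c = 0\<close> handles the sign in the differential equation; a general \<open>c\<close>
  yields the power term of the solution.\<close>

lemma frac_int_const_diff:
  assumes t: "t \<in> {a..b}" and pos: "\<gamma> > 0" and y: "continuous_on {a..b} y"
  shows "frac_int a b \<gamma> \<psi> (\<lambda>\<tau>. c - y \<tau>) t
    = c * (\<psi> t - \<psi> a) powr \<gamma> / Gamma (\<gamma> + 1) - frac_int a b \<gamma> \<psi> y t"
proof -
  have G: "Gamma (\<gamma> + 1) = \<gamma> * Gamma \<gamma>"
    using pos by (rule Gamma_real_plus1)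
  have "(LINT \<tau>:{a..t}|lebesgue. \<psi>' \<tau> * (\<psi> t - \<psi> \<tau>) powr (\<gamma> - 1) * (c - y \<tau>))
    = (LINT \<tau>:{a..t}|lebesgue. c * (\<psi>' \<tau> * (\<psi> t - \<psi> \<tau>) powr (\<gamma> - 1))
         - \<psi>' \<tau> * (\<psi> t - \<psi> \<tau>) powr (\<gamma> - 1) * y \<tau>)"
    by (simp add: algebra_simps)
  also have "\<dots> = c * ((\<psi> t - \<psi> a) powr \<gamma> / \<gamma>)
      - (LINT \<tau>:{a..t}|lebesgue. \<psi>' \<tau> * (\<psi> t - \<psi> \<tau>) powr (\<gamma> - 1) * y \<tau>)"
    using psi_kernel_integral[of t \<gamma>] psi_kernel_mult_integrable[of t \<gamma> y] t pos y
    by (subst set_integral_diff) auto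
  finally have I: "(LINT \<tau>:{a..t}|lebesgue. \<psi>' \<tau> * (\<psi> t - \<psi> \<tau>) powr (\<gamma> - 1) * (c - y \<tau>))
    = c * ((\<psi> t - \<psi> a) powr \<gamma> / \<gamma>)
      - (LINT \<tau>:{a..t}|lebesgue. \<psi>' \<tau> * (\<psi> t - \<psi> \<tau>) powr (\<gamma> - 1) * y \<tau>)" .
  show ?thesis
    using pos unfolding frac_int_def I by (simp add: G diff_divide_distrib mult.commute)
qed

text \<open>The differential equation holds only on the open interval. For positive order the
  endpoints are negligible, whereas order 0 would evaluate at \<open>t\<close> itself.\<close>

lemma frac_int_cong:
  assumes "\<gamma> > 0" "t \<in> {a..b}" "\<And>\<tau>. \<tau> \<in> {a<..<b} \<Longrightarrow> y \<tau> = z \<tau>"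
  shows "frac_int a b \<gamma> \<psi> y t = frac_int a b \<gamma> \<psi> z t"
proof -
  have "(LINT \<tau>:{a..t}|lebesgue. \<psi>' \<tau> * (\<psi> t - \<psi> \<tau>) powr (\<gamma> - 1) * y \<tau>)
      = (LINT \<tau>:{a..t}|lebesgue. \<psi>' \<tau> * (\<psi> t - \<psi> \<tau>) powr (\<gamma> - 1) * z \<tau>)"
    using assms by (intro set_integral_lebesgue_cong_except[of _ a b]) auto
  then show ?thesis using assms(1) by (simp add: frac_int_def)
qed

section \<open>The Green function as a kernel\<close>

text \<open>Both branches of \<open>green\<close> share the first term, and the second is present
  only for \<open>\<tau> \<le> t\<close>. The integral therefore splits into fractional integrals of
  order \<open>\<alpha> + \<beta>\<close> ending at \<open>b\<close> and at
  \<open>t\<close>.\<close>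

lemma green_integral:
  assumes t: "t \<in> {a..b}" and \<sigma>: "\<alpha> + \<beta> > 0" and F: "continuous_on {a..b} F"
  shows "(LINT \<tau>:{a..b}|lebesgue. green a b \<alpha> \<beta> \<psi> \<tau> t * \<psi>' \<tau> * F \<tau>)
    = (\<psi> t - \<psi> a) powr \<beta> / (\<psi> b - \<psi> a) powr \<beta> * frac_int a b (\<alpha> + \<beta>) \<psi> F b
      - frac_int a b (\<alpha> + \<beta>) \<psi> F t"
proof -
  \<comment> \<open>Unlike in \<open>green\<close>, here \<open>C\<close> absorbs the power of
    \<open>\<psi> t - \<psi> a\<close>, which is constant in \<open>\<tau>\<close>.\<close>
  define C D where "C = 1 / (Gamma (\<alpha> + \<beta>) * (\<psi> b - \<psi> a) powr \<beta>) * (\<psi> t - \<psi> a) powr \<beta>"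
    and "D = 1 / Gamma (\<alpha> + \<beta>)"
  define k where "k = (\<lambda>u \<tau>. \<psi>' \<tau> * (\<psi> u - \<psi> \<tau>) powr (\<alpha> + \<beta> - 1) * F \<tau>)"
  have k: "set_integrable lebesgue {a..u} (k u)" if "u \<in> {a..b}" for u
    unfolding k_def using that \<sigma> F by (intro psi_kernel_mult_integrable) auto
  have ind: "indicator {a..b} \<tau> *\<^sub>R (indicator {a..t} \<tau> * k t \<tau>) = indicator {a..t} \<tau> *\<^sub>R k t \<tau>" for \<tau>
    using t by (auto simp: indicator_def)
  have k': "set_integrable lebesgue {a..b} (\<lambda>\<tau>. indicator {a..t} \<tau> * k t \<tau>)"
    and k'': "(LINT \<tau>:{a..b}|lebesgue. indicator {a..t} \<tau> * k t \<tau>) = (LINT \<tau>:{a..t}|lebesgue. k t \<tau>)"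
    using k[OF t] by (simp_all only: set_integrable_def set_lebesgue_integral_def ind)
  have "(LINT \<tau>:{a..b}|lebesgue. green a b \<alpha> \<beta> \<psi> \<tau> t * \<psi>' \<tau> * F \<tau>)
      = (LINT \<tau>:{a..b}|lebesgue. C * k b \<tau> - D * (indicator {a..t} \<tau> * k t \<tau>))"
    by (rule set_lebesgue_integral_cong)
       (auto simp: green_def C_def D_def k_def Let_def indicator_def algebra_simps)
  also have "\<dots> = C * (LINT \<tau>:{a..b}|lebesgue. k b \<tau>) - D * (LINT \<tau>:{a..t}|lebesgue. k t \<tau>)"
    using k[of b] k' ab by (subst set_integral_diff) (auto simp: k'')
  finally show ?thesis
    using \<sigma> by (simp add: frac_int_def k_def C_def D_def)
qed

end

section \<open>Representation of the solution\<close>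

theorem lemma3p1:
  fixes a b \<alpha> \<beta> :: real
    and \<psi> x :: "real \<Rightarrow> real"
    and f :: "real \<Rightarrow> real \<Rightarrow> real"
    and \<G> :: "(real \<Rightarrow> real) \<Rightarrow> real"
  assumes "a < b"
    and "0 < \<alpha>" and "\<alpha> \<le> 1" and "0 < \<beta>" and "\<beta> \<le> 1" and "\<alpha> + \<beta> > 1"
    and "\<psi> \<in> C1_plus_on a b"
    and "bvp_solution a b \<alpha> \<beta> \<psi> f \<G> x"
    and "caputo a b \<beta> \<psi> x \<in> C1_on a b"
    and "(\<lambda>t. f t (x t)) \<in> C1_on a b"
  shows "\<forall>t\<in>{a..b}.
    x t = ((\<psi> t - \<psi> a) / (\<psi> b - \<psi> a)) powr \<beta> * \<G> (restrict x {a..b})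
        + (LINT \<tau>:{a..b}|lebesgue. green a b \<alpha> \<beta> \<psi> \<tau> t * deriv_on a b \<psi> \<tau> * f \<tau> (x \<tau>))"
proof
  fix t assume t: "t \<in> {a..b}"
  define F where "F = (\<lambda>\<tau>. f \<tau> (x \<tau>))"
  define v where "v = caputo a b \<beta> \<psi> x"
  have F: "continuous_on {a..b} F"
    using C1_on_continuous(1)[OF assms(10)] by (simp add: F_def)
  have v: "v \<in> C1_on a b" using assms(9) by (simp add: v_def)
  \<comment> \<open>The form \<open>0 - F \<tau>\<close> fits \<open>frac_int_const_diff\<close>
    with constant 0.\<close>
  have x: "x \<in> C1_on a b" and x_eq: "\<And>\<tau>. \<tau> \<in> {a<..<b} \<Longrightarrow> caputo a b \<alpha> \<psi> v \<tau> = 0 - F \<tau>"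
    and xa: "x a = 0" and xb: "x b = \<G> (restrict x {a..b})"
    using assms(8) by (auto simp: bvp_solution_def F_def v_def algebra_simps eq_neg_iff_add_eq_0)
  note \<psi> = assms(1,7)
  have IF_eq: "frac_int a b \<alpha> \<psi> F u = v a - v u" if u: "u \<in> {a..b}" for u
  proof -
    have "v u - v a = frac_int a b \<alpha> \<psi> (caputo a b \<alpha> \<psi> v) u"
      using frac_int_caputo[OF \<psi> u assms(2,3) v] by simp
    also have "\<dots> = frac_int a b \<alpha> \<psi> (\<lambda>\<tau>. 0 - F \<tau>) u"
      by (rule frac_int_cong[OF \<psi> assms(2) u x_eq])
    also have "\<dots> = - frac_int a b \<alpha> \<psi> F u"
      using frac_int_const_diff[OF \<psi> u assms(2) F, of 0] by simp
    finally show ?thesis by simp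
  qed
  \<comment> \<open>Continuity of \<open>I\<^sup>\<alpha> F\<close> comes for free from that of \<open>v\<close>.\<close>
  have IF_cont: "continuous_on {a..b} (frac_int a b \<alpha> \<psi> F)"
    using continuous_on_diff[OF continuous_on_const C1_on_continuous(1)[OF v], of "v a"]
    by (rule continuous_on_eq) (simp add: IF_eq)
  have x_rep: "x u = v a * (\<psi> u - \<psi> a) powr \<beta> / Gamma (\<beta> + 1) - frac_int a b (\<alpha> + \<beta>) \<psi> F u"
    if u: "u \<in> {a..b}" for u
  proof -
    \<comment> \<open>Inverting the inner Caputo derivative leaves no additive constant because
      \<open>x a = 0\<close>.\<close>
    have "x u = frac_int a b \<beta> \<psi> v u"
      using frac_int_caputo[OF \<psi> u assms(4,5) x] xa by (simp add: v_def)
    also have "\<dots> = frac_int a b \<beta> \<psi> (\<lambda>\<tau>. v a - frac_int a b \<alpha> \<psi> F \<tau>) u"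
      using assms(4) u by (intro frac_int_cong[OF \<psi>]) (auto simp: IF_eq)
    also have "\<dots> = v a * (\<psi> u - \<psi> a) powr \<beta> / Gamma (\<beta> + 1)
        - frac_int a b \<beta> \<psi> (frac_int a b \<alpha> \<psi> F) u"
      by (rule frac_int_const_diff[OF \<psi> u assms(4) IF_cont])
    also have "frac_int a b \<beta> \<psi> (frac_int a b \<alpha> \<psi> F) u = frac_int a b (\<alpha> + \<beta>) \<psi> F u"
      using frac_int_semigroup[OF \<psi> u assms(4) _ F, of \<alpha>] assms(2) by (simp add: add.commute)
    finally show ?thesis .
  qed
  define q where "q = ((\<psi> t - \<psi> a) / (\<psi> b - \<psi> a)) powr \<beta>"
  have less: "\<psi> a < \<psi> b" and le: "\<psi> a \<le> \<psi> t"
    using psi_less[OF \<psi>, of a b] psi_le[OF \<psi>, of a t] t assms(1) by auto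
  have q: "q = (\<psi> t - \<psi> a) powr \<beta> / (\<psi> b - \<psi> a) powr \<beta>"
    using less le by (simp add: q_def powr_divide)
  \<comment> \<open>The term with \<open>v a\<close> at \<open>t\<close> is \<open>q\<close> times
    the one at \<open>b\<close>, which \<open>x_rep\<close> at \<open>b\<close> expresses through
    \<open>x b\<close>; so \<open>v a\<close> is eliminated without being solved for.\<close>
  then have "(\<psi> t - \<psi> a) powr \<beta> = q * (\<psi> b - \<psi> a) powr \<beta>"
    using less by simp
  then have "v a * (\<psi> t - \<psi> a) powr \<beta> / Gamma (\<beta> + 1) = q * (x b + frac_int a b (\<alpha> + \<beta>) \<psi> F b)"
    using x_rep[of b] assms(1) by simp
  with x_rep[OF t] have "x t = q * x b + (q * frac_int a b (\<alpha> + \<beta>) \<psi> F b - frac_int a b (\<alpha> + \<beta>) \<psi> F t)"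
    by (simp add: algebra_simps)
  also have "q * frac_int a b (\<alpha> + \<beta>) \<psi> F b - frac_int a b (\<alpha> + \<beta>) \<psi> F t
      = (LINT \<tau>:{a..b}|lebesgue. green a b \<alpha> \<beta> \<psi> \<tau> t * deriv_on a b \<psi> \<tau> * F \<tau>)"
    using green_integral[OF \<psi> t _ F, of \<alpha> \<beta>] assms(6) by (simp add: q)
  finally show "x t = ((\<psi> t - \<psi> a) / (\<psi> b - \<psi> a)) powr \<beta> * \<G> (restrict x {a..b})
        + (LINT \<tau>:{a..b}|lebesgue. green a b \<alpha> \<beta> \<psi> \<tau> t * deriv_on a b \<psi> \<tau> * f \<tau> (x \<tau>))"
    by (simp add: xb q_def F_def)
qed

end
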